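(* Let $n\ge1$. The involution $\tilde\vartheta=\varphi^{-1}\circ\vartheta\circ\varphi:\mathcal P_n\to\mathcal P_n$ preserves the degree sequences and the statistic $\mathsf{rarm}$ and switches the statistics $\mathsf{larm}$ and $\mathsf{rev}$ (i.e. $\mathsf{larm}(\tilde\vartheta(T))=\mathsf{rev}(T)$ and $\mathsf{rev}(\tilde\vartheta(T))=\mathsf{larm}(T)$ for all $T\in\mathcal P_n$). In particular, $\mathsf{rev}$ interprets the Catalan triangle: for $1\le k\le n$, the number of $T\in\mathcal P_n$ with $\mathsf{rev}(T)=k$ equals $$C_{n,k}=\frac{k}{2n-k}\binom{2n-k}{n}.$$
   Context: **Plane and binary trees.** A plane tree is a rooted tree in which the children of each node are linearly ordered (left to right); $\mathcal P_n$ is the set of plane trees with $n$ edges. Nodes with the same parent are siblings; siblings to the left (right) of a node are its elder (younger) siblings. A binary tree is a rooted tree in which each node has at most one left child and at most one right child; $\mathcal B_n$ is the set of binary trees with $n$ nodes. The bijection $\varphi:\mathcal P_n\to\mathcal B_n$: the nodes of $\varphi(T)$ are the non-root nodes of $T$; its root is the leftmost child of the root of $T$; for non-root nodes $x,y$, $y$ is the left child of $x$ in $\varphi(T)$ iff $y$ is the leftmost child of $x$ in $T$, and $y$ is the right child of $x$ in $\varphi(T)$ iff $x$ is the closest elder sibling of $y$ in $T$. **The map $\vartheta:\mathcal B_n\to\mathcal B_n$.** Let $v_i$ be the $i$-th node of $B\in\mathcal B_n$ under the preorder (recursively: parent, left subtree, right subtree). Then $\vartheta(B)$ is the binary tree on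 the nodes $v_1,\dots,v_n$ with root $v_n$ such that, for $i$ from $n-1$ down to $1$: if $v_i$ has right child $v_\ell$ in $B$, then $v_i$ is the right child of $v_\ell$ in $\vartheta(B)$; otherwise $v_i$ is the left child of $v_{i+1}$ in $\vartheta(B)$. Trees are considered up to names of nodes. **Statistics of $T\in\mathcal P_n$.** - The degree of a node is its number of children; the degree sequence of $T$ is the multiset of degrees of all internal (non-leaf) nodes. - $\mathsf{larm}(T)$ is the number of edges of the left arm: the path starting at the root and going repeatedly to the leftmost child until a leaf is reached. $\mathsf{rarm}(T)$ is the number of edges of the right arm, defined in the same way with rightmost children. - Preorder on $T$: recursively visit the parent, then the subtrees of its children from left to right; the reverse preorder on $T$ is the reversal of the preorder. $\mathsf{rev}(T)$ is the number of nodes before the first node, under the reverse preorder, that has a younger sibling; by convention $\mathsf{rev}(T)=n$ if $T$ is the path with $n$ edges. *)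

theory Defs
  imports Complex_Main "HOL-Library.Multiset" "HOL-Library.Tree"
begin

section \<open>Plane trees and their statistics\<close>

datatype ptree = PNode (children: "ptree list")

fun edges :: "ptree \<Rightarrow> nat" where
  "edges (PNode ts) = (\<Sum>t\<leftarrow>ts. Suc (edges t))"

definition plane_trees :: "nat \<Rightarrow> ptree set" where
  "plane_trees n = {T. edges T = n}"

fun degree_sequence :: "ptree \<Rightarrow> nat multiset" where
  "degree_sequence (PNode ts) =
     (if ts = [] then {#} else {#length ts#}) + (\<Sum>t\<leftarrow>ts. degree_sequence t)"

fun larm :: "ptree \<Rightarrow> nat" where
  "larm (PNode []) = 0"
| "larm (PNode (t # ts)) = Suc (larm t)"

function rarm :: "ptree \<Rightarrow> nat" where
  "rarm (PNode ts) = (if ts = [] then 0 else Suc (rarm (last ts)))"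
  by pat_completeness auto
termination
  by (relation "measure size") (auto dest!: last_in_set size_list_estimation' [OF _ order_refl, where f = size])

text \<open>
  \<open>younger_flags T\<close> lists, for the nodes of \<open>T\<close> in preorder, whether the node has a younger
  sibling.  \<open>younger_flags_forest ts\<close> does the same for a maximal run \<open>ts\<close> of consecutive siblings
  with their subtrees, ending at the youngest sibling.
\<close>

fun younger_flags_forest :: "ptree list \<Rightarrow> bool list" where
  "younger_flags_forest [] = []"
| "younger_flags_forest (PNode us # ts) =
     (ts \<noteq> []) # younger_flags_forest us @ younger_flags_forest ts"

definition younger_flags :: "ptree \<Rightarrow> bool list" where
  "younger_flags T = False # younger_flags_forest (children T)"

definition path_tree :: "nat \<Rightarrow> ptree" where
  "path_tree n = ((\<lambda>t. PNode [t]) ^^ n) (PNode [])"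

text \<open>Inside the definition, \<open>rev\<close> is list reversal.\<close>

definition rev_stat :: "ptree \<Rightarrow> nat" where
  "rev_stat T =
     (if T = path_tree (edges T) then edges T
      else length (takeWhile Not (rev (younger_flags T))))"


section \<open>The bijection from plane trees to binary trees\<close>

text \<open>
  Binary trees up to names of nodes are the elements of \<^typ>\<open>unit tree\<close>, where \<^const>\<open>Leaf\<close> is the
  empty tree and \<^const>\<open>size\<close> counts the nodes.

  \<open>phi_forest ts\<close> is the part of the binary tree rooted at the node \<open>x\<close> that heads the run \<open>ts\<close> of
  consecutive siblings: the left child of \<open>x\<close> is the leftmost child of \<open>x\<close> in the plane tree, its
  right child is the sibling immediately to the right of \<open>x\<close>.
\<close>

definition binary_trees :: "nat \<Rightarrow> unit tree set" where
  "binary_trees n = {B. size B = n}"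

fun phi_forest :: "ptree list \<Rightarrow> unit tree" where
  "phi_forest [] = Leaf"
| "phi_forest (PNode us # ts) = Node (phi_forest us) () (phi_forest ts)"

definition phi :: "ptree \<Rightarrow> unit tree" where
  "phi T = phi_forest (children T)"

fun unphi_forest :: "unit tree \<Rightarrow> ptree list" where
  "unphi_forest Leaf = []"
| "unphi_forest (Node l _ r) = PNode (unphi_forest l) # unphi_forest r"

lemma unphi_forest_phi_forest: "unphi_forest (phi_forest ts) = ts"
  by (induction ts rule: phi_forest.induct) auto

lemma phi_forest_unphi_forest: "phi_forest (unphi_forest B) = B"
  by (induction B) auto

lemma bij_phi: "bij phi"
proof (rule o_bij)
  show "(PNode \<circ> unphi_forest) \<circ> phi = id"
    by (auto simp: fun_eq_iff phi_def unphi_forest_phi_forest)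
  show "phi \<circ> (PNode \<circ> unphi_forest) = id"
    by (auto simp: fun_eq_iff phi_def phi_forest_unphi_forest)
qed

lemma size_phi_forest: "size (phi_forest ts) = (\<Sum>t\<leftarrow>ts. Suc (edges t))"
  by (induction ts rule: phi_forest.induct) auto

lemma size_phi: "size (phi T) = edges T"
  by (cases T) (simp add: phi_def size_phi_forest)

lemma bij_betw_phi: "bij_betw phi (plane_trees n) (binary_trees n)"
proof -
  have "phi ` plane_trees n = binary_trees n"
  proof
    show "phi ` plane_trees n \<subseteq> binary_trees n"
      by (auto simp: plane_trees_def binary_trees_def size_phi)
    show "binary_trees n \<subseteq> phi ` plane_trees n"
    proof
      fix B assume "B \<in> binary_trees n"
      moreover obtain T where "B = phi T" using bij_phi by (metis bij_pointE)
      ultimately show "B \<in> phi ` plane_trees n"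
        by (simp add: plane_trees_def binary_trees_def size_phi)
    qed
  qed
  moreover have "inj_on phi (plane_trees n)"
    using bij_is_inj[OF bij_phi] by (rule inj_on_subset) simp
  ultimately show ?thesis by (simp add: bij_betw_def)
qed


section \<open>The map theta on binary trees\<close>

text \<open>
  \<open>left_child t x y\<close> and \<open>right_child t x y\<close> say that \<open>y\<close> is the left (right) child of \<open>x\<close>; they are
  used for trees whose nodes carry distinct names.
\<close>

definition left_child :: "'a tree \<Rightarrow> 'a \<Rightarrow> 'a \<Rightarrow> bool" where
  "left_child t x y \<longleftrightarrow> (\<exists>a b r. \<langle>\<langle>a, y, b\<rangle>, x, r\<rangle> \<in> subtrees t)"

definition right_child :: "'a tree \<Rightarrow> 'a \<Rightarrow> 'a \<Rightarrow> bool" where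
  "right_child t x y \<longleftrightarrow> (\<exists>l a b. \<langle>l, x, \<langle>a, y, b\<rangle>\<rangle> \<in> subtrees t)"

text \<open>\<open>number i B\<close> names the nodes of \<open>B\<close> by \<open>i, i + 1, \<dots>\<close> in preorder.\<close>

fun number :: "nat \<Rightarrow> 'a tree \<Rightarrow> nat tree" where
  "number i \<langle>\<rangle> = \<langle>\<rangle>"
| "number i \<langle>l, x, r\<rangle> = \<langle>number (Suc i) l, i, number (Suc i + size l) r\<rangle>"

lemma preorder_number: "preorder (number i B) = [i..<i + size B]"
proof (induction B arbitrary: i)
  case (Node l x r)
  have "[i..<i + size \<langle>l, x, r\<rangle>] = i # [Suc i..<Suc i + (size l + size r)]"
    by (simp add: upt_conv_Cons del: upt_Suc)
  also have "[Suc i..<Suc i + (size l + size r)] =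
      [Suc i..<Suc i + size l] @ [Suc i + size l..<Suc i + size l + size r]"
    using upt_add_eq_append[of "Suc i" "Suc i + size l" "size r"] by (simp add: add.assoc)
  finally show ?case using Node by simp
qed simp

text \<open>The node \<open>v\<^sub>i\<close> is named \<open>i\<close>, both in \<open>B\<close> and in the tree \<open>T\<close> being specified.\<close>

definition theta_spec :: "'a tree \<Rightarrow> nat tree \<Rightarrow> bool" where
  "theta_spec B T \<longleftrightarrow>
     distinct (preorder T) \<and> set_tree T = {1..size B} \<and>
     (T \<noteq> Leaf \<longrightarrow> value T = size B) \<and>
     (\<forall>i\<in>{1..<size B}.
        (\<forall>l. right_child (number 1 B) i l \<longrightarrow> right_child T l i) \<and>
        ((\<nexists>l. right_child (number 1 B) i l) \<longrightarrow> left_child T (Suc i) i))"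

definition theta :: "unit tree \<Rightarrow> unit tree" where
  "theta B = map_tree (\<lambda>_. ()) (THE T. theta_spec B T)"

definition theta_tilde :: "ptree \<Rightarrow> ptree" where
  "theta_tilde = inv phi \<circ> theta \<circ> phi"


subsection \<open>The specification of theta determines a unique tree\<close>

lemma root_in_subtrees [simp]: "t \<in> subtrees t"
  by (cases t) auto

lemma subtrees_trans: "s \<in> subtrees t \<Longrightarrow> subtrees s \<subseteq> subtrees t"
  by (induction t) auto

lemma subtree_set: "\<langle>l, x, r\<rangle> \<in> subtrees t \<Longrightarrow> x \<in> set_tree t \<and> set_tree l \<subseteq> set_tree t \<and> set_tree r \<subseteq> set_tree t"
  by (induction t) auto

lemma subtree_unique:
  assumes "distinct (preorder t)" "\<langle>l, x, r\<rangle> \<in> subtrees t" "\<langle>l', x, r'\<rangle> \<in> subtrees t"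
  shows "l = l' \<and> r = r'"
  using assms
proof (induction t)
  case (Node a y b)
  have d: "y \<notin> set_tree a" "y \<notin> set_tree b" "set_tree a \<inter> set_tree b = {}"
    using Node.prems(1) by auto
  have in_root: "u = a \<and> v = b" if "\<langle>u, y, v\<rangle> \<in> subtrees \<langle>a, y, b\<rangle>" for u v
    using that d(1,2) subtree_set[of u y v a] subtree_set[of u y v b] by auto
  have in_sub: "x \<in> set_tree a \<and> \<langle>u, x, v\<rangle> \<in> subtrees a \<or> x \<in> set_tree b \<and> \<langle>u, x, v\<rangle> \<in> subtrees b"
    if "\<langle>u, x, v\<rangle> \<in> subtrees \<langle>a, y, b\<rangle>" "x \<noteq> y" for u v
    using that subtree_set[of u x v a] subtree_set[of u x v b] by simp blast
  show ?case
  proof (cases "x = y")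
    case True
    then show ?thesis using in_root Node.prems(2,3) by metis
  next
    case False
    have "distinct (preorder a)" "distinct (preorder b)" using Node.prems(1) by simp_all
    then show ?thesis
      using in_sub[OF Node.prems(2) False] in_sub[OF Node.prems(3) False] d(3)
        Node.IH by (metis disjoint_iff)
  qed
qed simp

lemma left_child_set: "left_child t x y \<Longrightarrow> x \<in> set_tree t \<and> y \<in> set_tree t"
  unfolding left_child_def by (auto dest!: subtree_set)

lemma right_child_set: "right_child t x y \<Longrightarrow> x \<in> set_tree t \<and> y \<in> set_tree t"
  unfolding right_child_def by (auto dest!: subtree_set)

lemma ex_Node_iff: "(\<exists>a b. t = \<langle>a, y, b\<rangle>) \<longleftrightarrow> t \<noteq> \<langle>\<rangle> \<and> y = value t"
  by (cases t) auto

lemma left_child_Node: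
  "left_child \<langle>l, z, r\<rangle> x y \<longleftrightarrow>
     x = z \<and> l \<noteq> \<langle>\<rangle> \<and> y = value l \<or> left_child l x y \<or> left_child r x y"
  unfolding left_child_def subtrees.simps Un_iff ex_disj_distrib
  using ex_Node_iff[of l y] by auto

lemma right_child_Node:
  "right_child \<langle>l, z, r\<rangle> x y \<longleftrightarrow>
     x = z \<and> r \<noteq> \<langle>\<rangle> \<and> y = value r \<or> right_child l x y \<or> right_child r x y"
  unfolding right_child_def subtrees.simps Un_iff ex_disj_distrib
  using ex_Node_iff[of r y] by auto

lemma not_child_Leaf [simp]: "\<not> left_child \<langle>\<rangle> x y" "\<not> right_child \<langle>\<rangle> x y"
  by (auto simp: left_child_def right_child_def)

lemma value_in_set: "t \<noteq> \<langle>\<rangle> \<Longrightarrow> value t \<in> set_tree t"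
  by (cases t) auto

lemma child_not_root:
  assumes "distinct (preorder t)" "left_child t x y \<or> right_child t x y"
  shows "y \<noteq> value t"
proof (cases t)
  case (Node a z b)
  then have "z \<notin> set_tree a" "z \<notin> set_tree b" using assms(1) by auto
  then show ?thesis
    using assms(2) Node value_in_set[of a] value_in_set[of b]
    by (auto simp: left_child_Node right_child_Node dest: left_child_set right_child_set)
qed (use assms in simp)

lemma parent_unique:
  assumes "distinct (preorder t)"
  shows "(left_child t x y \<longrightarrow> left_child t x' y \<longrightarrow> x = x') \<and>
         (right_child t x y \<longrightarrow> right_child t x' y \<longrightarrow> x = x') \<and>
         \<not> (left_child t x y \<and> right_child t x' y)"
  using assms
proof (induction t)
  case (Node a z b)
  have d: "distinct (preorder a)" "distinct (preorder b)" "set_tree a \<inter> set_tree b = {}"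
    using Node.prems by auto
  have a: "y \<in> set_tree a \<and> y \<noteq> value a" if "left_child a u y \<or> right_child a u y" for u
    using that child_not_root[OF d(1)] left_child_set right_child_set by metis
  have b: "y \<in> set_tree b \<and> y \<noteq> value b" if "left_child b u y \<or> right_child b u y" for u
    using that child_not_root[OF d(2)] left_child_set right_child_set by metis
  show ?case
  proof (cases "y \<in> set_tree a")
    case True
    then have "y \<notin> set_tree b" using d(3) by blast
    then have "\<not> left_child b u y" "\<not> right_child b u y" "b \<noteq> \<langle>\<rangle> \<Longrightarrow> y \<noteq> value b" for u
      using b value_in_set[of b] by auto
    then show ?thesis
      using Node.IH(1)[OF d(1)] a[of x] a[of x'] unfolding left_child_Node right_child_Node
      by metis
  next
    case False
    then have "\<not> left_child a u y" "\<not> right_child a u y" "a \<noteq> \<langle>\<rangle> \<Longrightarrow> y \<noteq> value a" for u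
      using a value_in_set[of a] by auto
    then show ?thesis
      using Node.IH(2)[OF d(2)] b[of x] b[of x'] unfolding left_child_Node right_child_Node
      by metis
  qed
qed simp

lemma tree_eqI_aux:
  assumes "distinct (preorder t)" "distinct (preorder t')"
    and "left_child t = left_child t'" "right_child t = right_child t'"
    and "s \<in> subtrees t" "s' \<in> subtrees t'"
    and "s = \<langle>\<rangle> \<longleftrightarrow> s' = \<langle>\<rangle>" "s \<noteq> \<langle>\<rangle> \<longrightarrow> value s = value s'"
  shows "s = s'"
  using assms(5-8)
proof (induction s arbitrary: s')
  case (Node a x b)
  then obtain a' b' where s': "s' = \<langle>a', x, b'\<rangle>" by (cases s') auto
  have L: "left_child t x y \<longleftrightarrow> a \<noteq> \<langle>\<rangle> \<and> y = value a" for y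
    using Node.prems(1) subtree_unique[OF assms(1)] unfolding left_child_def
    by (metis tree.collapse tree.distinct(1) tree.sel)
  have R: "right_child t x y \<longleftrightarrow> b \<noteq> \<langle>\<rangle> \<and> y = value b" for y
    using Node.prems(1) subtree_unique[OF assms(1)] unfolding right_child_def
    by (metis tree.collapse tree.distinct(1) tree.sel)
  have L': "left_child t' x y \<longleftrightarrow> a' \<noteq> \<langle>\<rangle> \<and> y = value a'" for y
    using Node.prems(2) s' subtree_unique[OF assms(2)] unfolding left_child_def
    by (metis tree.collapse tree.distinct(1) tree.sel)
  have R': "right_child t' x y \<longleftrightarrow> b' \<noteq> \<langle>\<rangle> \<and> y = value b'" for y
    using Node.prems(2) s' subtree_unique[OF assms(2)] unfolding right_child_def
    by (metis tree.collapse tree.distinct(1) tree.sel)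
  have sub: "a \<in> subtrees t" "b \<in> subtrees t" "a' \<in> subtrees t'" "b' \<in> subtrees t'"
    using subtrees_trans[OF Node.prems(1)] subtrees_trans[OF Node.prems(2)] s' by auto
  have "a = a'"
    by (rule Node.IH(1)) (use sub L L' assms(3) in metis)+
  moreover have "b = b'"
    by (rule Node.IH(2)) (use sub R R' assms(4) in metis)+
  ultimately show ?case using s' by simp
qed simp

lemma theta_spec_child_le:
  assumes "theta_spec B T" "theta_spec B T'"
  shows "left_child T x y \<Longrightarrow> left_child T' x y" "right_child T x y \<Longrightarrow> right_child T' x y"
proof -
  have d: "distinct (preorder T)" and st: "set_tree T = {1..size B}"
    and rt: "T \<noteq> \<langle>\<rangle> \<longrightarrow> value T = size B"
    using assms(1) by (auto simp: theta_spec_def)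
  have *: "y \<in> {1..<size B}" if "left_child T x y \<or> right_child T x y"
  proof -
    have "y \<in> set_tree T" "T \<noteq> \<langle>\<rangle>"
      using that left_child_set right_child_set by (metis not_child_Leaf)+
    moreover have "y \<noteq> value T" by (rule child_not_root[OF d that])
    ultimately show ?thesis using st rt by auto
  qed
  have **: "(\<exists>z. right_child T z y \<and> right_child T' z y) \<or>
      (left_child T (Suc y) y \<and> left_child T' (Suc y) y)" if "y \<in> {1..<size B}"
    using that assms unfolding theta_spec_def by metis
  show "left_child T x y \<Longrightarrow> left_child T' x y" "right_child T x y \<Longrightarrow> right_child T' x y"
    using * ** parent_unique[OF d] by metis+
qed

lemma theta_spec_unique:
  assumes "theta_spec B T" "theta_spec B T'"
  shows "T = T'"
proof (rule tree_eqI_aux[of T T'])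
  show "left_child T = left_child T'" "right_child T = right_child T'"
    using theta_spec_child_le assms by blast+
  show "T = \<langle>\<rangle> \<longleftrightarrow> T' = \<langle>\<rangle>" "T \<noteq> \<langle>\<rangle> \<longrightarrow> value T = value T'"
    using assms unfolding theta_spec_def by (metis eq_set_tree_empty)+
qed (use assms in \<open>auto simp: theta_spec_def\<close>)

text \<open>
  For existence, \<open>theta_aux i B t\<^sub>1 t\<^sub>2\<close> is the tree built from \<open>B\<close>, numbered from \<open>i\<close>, in which the
  first node, a leaf of the tree built so far, receives \<open>t\<^sub>1\<close> and \<open>t\<^sub>2\<close> as left and right subtrees.
\<close>

fun theta_aux :: "nat \<Rightarrow> 'a tree \<Rightarrow> nat tree \<Rightarrow> nat tree \<Rightarrow> nat tree" where
  "theta_aux i \<langle>\<rangle> t1 t2 = t1"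
| "theta_aux i \<langle>l, x, r\<rangle> t1 t2 =
     (if r = \<langle>\<rangle> then theta_aux (Suc i) l \<langle>t1, i, t2\<rangle> \<langle>\<rangle>
      else theta_aux (Suc i + size l) r (theta_aux (Suc i) l \<langle>\<rangle> \<langle>\<rangle>) \<langle>t1, i, t2\<rangle>)"

lemma right_child_number:
  "right_child (number i \<langle>l, x, r\<rangle>) j m \<longleftrightarrow>
     j = i \<and> r \<noteq> \<langle>\<rangle> \<and> m = Suc i + size l \<or> right_child (number (Suc i) l) j m \<or>
     right_child (number (Suc i + size l) r) j m"
  by (cases r) (simp_all add: right_child_Node)

lemma right_child_number_bounds:
  "right_child (number i B) j m \<Longrightarrow> i \<le> j \<and> j < m \<and> m < i + size B"
proof (induction B arbitrary: i)
  case (Node l x r)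
  then show ?case
    unfolding right_child_number by (cases r) (fastforce dest!: Node.IH simp del: number.simps)+
qed simp

lemma theta_aux_value:
  "B \<noteq> \<langle>\<rangle> \<Longrightarrow> theta_aux i B t1 t2 \<noteq> \<langle>\<rangle> \<and> Suc (value (theta_aux i B t1 t2)) = i + size B"
proof (induction B arbitrary: i t1 t2)
  case (Node l x r)
  then show ?case by (cases "l = \<langle>\<rangle>"; cases "r = \<langle>\<rangle>") auto
qed simp

lemma theta_aux_mset:
  "B \<noteq> \<langle>\<rangle> \<or> t2 = \<langle>\<rangle> \<Longrightarrow>
   mset (preorder (theta_aux i B t1 t2)) =
     mset (preorder (number i B)) + mset (preorder t1) + mset (preorder t2)"
  by (induction B arbitrary: i t1 t2) auto

lemma theta_aux_subtrees:
  "B \<noteq> \<langle>\<rangle> \<or> t2 = \<langle>\<rangle> \<Longrightarrow>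
   t1 \<in> subtrees (theta_aux i B t1 t2) \<and>
   (B \<noteq> \<langle>\<rangle> \<longrightarrow> \<langle>t1, i, t2\<rangle> \<in> subtrees (theta_aux i B t1 t2))"
proof (induction B arbitrary: i t1 t2)
  case (Node l x r)
  have "\<langle>t1, i, t2\<rangle> \<in> subtrees (theta_aux i \<langle>l, x, r\<rangle> t1 t2)"
  proof (cases "r = \<langle>\<rangle>")
    case True
    then show ?thesis using Node.IH(1)[of "\<langle>\<rangle>" "\<langle>t1, i, t2\<rangle>" "Suc i"] by simp
  next
    case False
    let ?u = "theta_aux (Suc i) l \<langle>\<rangle> \<langle>\<rangle>"
    have "\<langle>?u, Suc i + size l, \<langle>t1, i, t2\<rangle>\<rangle> \<in> subtrees (theta_aux i \<langle>l, x, r\<rangle> t1 t2)"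
      using Node.IH(2)[of "\<langle>t1, i, t2\<rangle>" ?u "Suc i + size l"] False by simp
    from subtrees_trans[OF this] show ?thesis
      by (simp only: subtrees.simps) (meson UnI1 UnI2 in_mono insertI1)
  qed
  moreover from subtrees_trans[OF this]
  have "t1 \<in> subtrees (theta_aux i \<langle>l, x, r\<rangle> t1 t2)"
    by (simp only: subtrees.simps) (meson UnI1 UnI2 in_mono root_in_subtrees)
  ultimately show ?case by blast
qed simp

lemma left_child_mono: "s \<in> subtrees t \<Longrightarrow> left_child s x y \<Longrightarrow> left_child t x y"
  using subtrees_trans unfolding left_child_def by blast

lemma right_child_mono: "s \<in> subtrees t \<Longrightarrow> right_child s x y \<Longrightarrow> right_child t x y"
  using subtrees_trans unfolding right_child_def by blast

lemma left_childI: "\<langle>u, x, r\<rangle> \<in> subtrees t \<Longrightarrow> u \<noteq> \<langle>\<rangle> \<Longrightarrow> left_child t x (value u)"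
  unfolding left_child_def by (cases u) auto

lemma theta_aux_spec:
  assumes "B \<noteq> \<langle>\<rangle> \<or> t2 = \<langle>\<rangle>" "i \<le> j" "Suc j < i + size B"
  shows "(\<forall>m. right_child (number i B) j m \<longrightarrow> right_child (theta_aux i B t1 t2) m j) \<and>
         ((\<nexists>m. right_child (number i B) j m) \<longrightarrow> left_child (theta_aux i B t1 t2) (Suc j) j)"
  using assms
proof (induction B arbitrary: i t1 t2)
  case (Node l x r)
  define k where "k = Suc i + size l"
  define w where "w = \<langle>t1, i, t2\<rangle>"
  define C where "C = theta_aux i \<langle>l, x, r\<rangle> t1 t2"
  have rc: "right_child (number i \<langle>l, x, r\<rangle>) j m \<longleftrightarrow>
     j = i \<and> r \<noteq> \<langle>\<rangle> \<and> m = k \<or> right_child (number (Suc i) l) j m \<or>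
     right_child (number k r) j m" for m
    unfolding right_child_number k_def ..
  note bl = right_child_number_bounds[of "Suc i" l j]
  note br = right_child_number_bounds[of k r j]
  have "(\<forall>m. right_child (number i \<langle>l, x, r\<rangle>) j m \<longrightarrow> right_child C m j) \<and>
         ((\<nexists>m. right_child (number i \<langle>l, x, r\<rangle>) j m) \<longrightarrow> left_child C (Suc j) j)"
  proof (cases "r = \<langle>\<rangle>")
    case True
    have C: "C = theta_aux (Suc i) l w \<langle>\<rangle>" by (simp add: C_def w_def True)
    show ?thesis
    proof (cases "j = i")
      case True
      have "l \<noteq> \<langle>\<rangle>" using Node.prems(3) \<open>r = \<langle>\<rangle>\<close> True by auto
      then have "\<langle>w, Suc i, \<langle>\<rangle>\<rangle> \<in> subtrees C"
        using theta_aux_subtrees[of l "\<langle>\<rangle>" w "Suc i"] C by simp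
      then have "left_child C (Suc i) i"
        using left_childI[of w "Suc i" "\<langle>\<rangle>" C] by (simp add: w_def)
      then show ?thesis using True \<open>r = \<langle>\<rangle>\<close> rc bl by auto
    next
      case False
      then show ?thesis
        using Node.IH(1)[of "\<langle>\<rangle>" "Suc i" w] Node.prems C rc \<open>r = \<langle>\<rangle>\<close> by simp
    qed
  next
    case False
    define u where "u = theta_aux (Suc i) l \<langle>\<rangle> \<langle>\<rangle>"
    have C: "C = theta_aux k r u w" by (simp add: C_def w_def u_def k_def False)
    have N: "\<langle>u, k, w\<rangle> \<in> subtrees C"
      using theta_aux_subtrees[of r w u k] C False by simp
    from subtrees_trans[OF N] have U: "u \<in> subtrees C"
      by (simp only: subtrees.simps) (meson UnI1 UnI2 in_mono root_in_subtrees)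
    consider "j = i" | "i < j" "Suc j < k" | "i < j" "Suc j = k" | "k \<le> j"
      using Node.prems(2) by linarith
    then show ?thesis
    proof cases
      case 1
      have "right_child C k i" using N unfolding right_child_def w_def by blast
      then show ?thesis using 1 rc bl br False unfolding k_def by auto
    next
      case 2
      then show ?thesis
        using Node.IH(1)[of "\<langle>\<rangle>" "Suc i" "\<langle>\<rangle>"] rc br U left_child_mono right_child_mono
        unfolding u_def[symmetric] by (fastforce simp: k_def)
    next
      case 3
      then have "l \<noteq> \<langle>\<rangle>" by (auto simp: k_def)
      then have "u \<noteq> \<langle>\<rangle>" "value u = j"
        using theta_aux_value[of l "Suc i" "\<langle>\<rangle>" "\<langle>\<rangle>"] 3 by (auto simp: u_def k_def)
      then have "left_child C (Suc j) j" using left_childI[OF N] 3 by simp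
      moreover have "\<not> right_child (number i \<langle>l, x, r\<rangle>) j m" for m
        using rc bl[of m] br[of m] 3 by (auto simp: k_def)
      ultimately show ?thesis by simp
    next
      case 4
      have "\<not> right_child (number (Suc i) l) j m" for m using bl[of m] 4 by (auto simp: k_def)
      then show ?thesis
        using Node.IH(2)[of w k u] Node.prems(3) 4 False rc C by (auto simp: k_def)
    qed
  qed
  then show ?case unfolding C_def .
qed simp

lemma theta_spec_theta_aux: "theta_spec B (theta_aux 1 B \<langle>\<rangle> \<langle>\<rangle>)"
proof -
  let ?T = "theta_aux 1 B \<langle>\<rangle> \<langle>\<rangle>"
  have m: "mset (preorder ?T) = mset [1..<Suc (size B)]"
    by (simp add: theta_aux_mset preorder_number del: upt_Suc)
  have "distinct (preorder ?T)" using mset_eq_imp_distinct_iff[OF m] by simp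
  moreover have "set_tree ?T = {1..size B}"
    using mset_eq_setD[OF m] by (simp add: atLeastLessThanSuc_atLeastAtMost del: upt_Suc)
  moreover have "?T \<noteq> \<langle>\<rangle> \<longrightarrow> value ?T = size B"
    using theta_aux_value[of B 1 "\<langle>\<rangle>" "\<langle>\<rangle>"] by (cases "B = \<langle>\<rangle>") auto
  ultimately show ?thesis
    unfolding theta_spec_def using theta_aux_spec[of B "\<langle>\<rangle>" 1 _ "\<langle>\<rangle>"] by simp
qed

lemma theta_spec_ex1: "\<exists>!T. theta_spec B T"
  using theta_spec_theta_aux theta_spec_unique by blast

lemma theta_eq: "theta B = map_tree (\<lambda>_. ()) (theta_aux 1 B \<langle>\<rangle> \<langle>\<rangle>)"
  unfolding theta_def using theta_spec_theta_aux theta_spec_unique by (metis the_equality)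

lemma size_theta: "size (theta B) = size B"
proof (cases B)
  case (Node l x r)
  have "size (theta_aux 1 B \<langle>\<rangle> \<langle>\<rangle>) = length (preorder (theta_aux 1 B \<langle>\<rangle> \<langle>\<rangle>))" by simp
  also have "\<dots> = length (preorder (number 1 B))"
    using theta_aux_mset[of B "\<langle>\<rangle>" 1 "\<langle>\<rangle>"] by (metis add.right_neutral mset.simps(1) preorder.simps(1) size_mset)
  also have "\<dots> = size B" by (simp only: preorder_number length_upt)
  finally show ?thesis by (simp add: theta_eq)
qed (simp add: theta_eq)

end

theory Submission
  imports Defs "HOL-Library.FuncSet"
begin

text \<open>
  Number the nodes of \<open>B\<close> in preorder and draw an arc from each node to its right child.  The result
  is the arc diagram of a noncrossing partition, whose blocks are the maximal right chains of \<open>B\<close>,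
  that is, the sibling groups of the plane tree; the diagram is determined by recording for each
  node whether it ends an arc and whether it starts one.  The map \<^const>\<open>theta\<close> reflects the diagram,
  which makes it an involution preserving the block sizes (the degrees) and the number of outer
  blocks (the right arm).  The left arm consists of the nodes before the first end of an arc, and
  \<^const>\<open>rev_stat\<close> counts the nodes after the last start of an arc, so the two are exchanged.

  For the enumeration, a plane tree whose left arm has \<open>k\<close> edges amounts to a list of \<open>k\<close> plane trees,
  and splitting the first tree of such a list at its leftmost edge gives the recurrence of
  the ballot numbers.
\<close>

section \<open>Theta reflects the arc diagram\<close>

text \<open>The flag \<open>g\<close> tells whether the root is itself a right child, which the
  subtree alone does not show.\<close>

fun arcs :: "bool \<Rightarrow> 'a tree \<Rightarrow> (bool \<times> bool) list" where
  "arcs g \<langle>\<rangle> = []"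
| "arcs g \<langle>l, x, r\<rangle> = (g, r \<noteq> \<langle>\<rangle>) # arcs False l @ arcs True r"

lemma arcs_map_tree [simp]: "arcs g (map_tree f t) = arcs g t"
  by (induction t arbitrary: g) auto

lemma arcs_eq_Nil_iff [simp]: "arcs g t = [] \<longleftrightarrow> t = \<langle>\<rangle>"
  by (cases t) auto

lemma fst_hd_arcs: "t \<noteq> \<langle>\<rangle> \<Longrightarrow> fst (hd (arcs g t)) = g"
  by (cases t) auto

text \<open>In the word of a tree, a complete subtree is followed by the end or by a right child.\<close>

lemma arcs_append_inject:
  fixes t t' :: "unit tree"
  assumes "arcs g t @ xs = arcs g t' @ ys"
    and "xs = [] \<or> fst (hd xs)" "ys = [] \<or> fst (hd ys)"
    and "g \<Longrightarrow> t \<noteq> \<langle>\<rangle> \<and> t' \<noteq> \<langle>\<rangle>"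
  shows "t = t' \<and> xs = ys"
  using assms
proof (induction t arbitrary: g t' xs ys)
  case Leaf
  then show ?case using fst_hd_arcs[of t' g] by (cases t') auto
next
  case (Node l x r)
  show ?case
  proof (cases t')
    case Leaf
    then show ?thesis using Node.prems by auto
  next
    case (Node l' x' r')
    have eq: "arcs False l @ (arcs True r @ xs) = arcs False l' @ (arcs True r' @ ys)"
      and r: "r = \<langle>\<rangle> \<longleftrightarrow> r' = \<langle>\<rangle>"
      using Node.prems(1) Node by auto
    \<comment> \<open>What follows \<open>l\<close> is the word of a right child or, if
      \<open>r\<close> is empty, the outer rest; both meet the stopping condition.\<close>
    have "l = l' \<and> arcs True r @ xs = arcs True r' @ ys"
      by (rule Node.IH(1)[OF eq])
        (use Node.prems(2,3) r fst_hd_arcs[of r True] fst_hd_arcs[of r' True]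
          in \<open>auto simp: hd_append\<close>)
    moreover from this have "r = r' \<and> xs = ys"
    proof (cases "r = \<langle>\<rangle>")
      case False
      then show ?thesis using calculation r by (intro Node.IH(2)[of True]) (use Node.prems in auto)
    qed (use r in auto)
    ultimately show ?thesis using Node by simp
  qed
qed

lemma arcs_False_inject: "arcs False t = arcs False t' \<Longrightarrow> t = t'" for t t' :: "unit tree"
  using arcs_append_inject[of False t "[]" t' "[]"] by simp

text \<open>Later nodes of \<open>B\<close> come earlier in the new preorder. The first node gets
  right subtree \<open>t2\<close>, so it starts an arc exactly when, by the flag for
  \<open>B\<close>, it ended one.\<close>

lemma arcs_theta_aux:
  "B \<noteq> \<langle>\<rangle> \<or> t2 = \<langle>\<rangle> \<Longrightarrow>
   arcs False (theta_aux i B t1 t2) =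
     rev (map prod.swap (arcs (t2 \<noteq> \<langle>\<rangle>) B)) @ arcs False t1 @ arcs True t2"
  by (induction B arbitrary: i t1 t2) auto

lemma arcs_theta: "arcs False (theta B) = rev (map prod.swap (arcs False B))"
  by (simp add: theta_eq arcs_theta_aux)

lemma theta_theta: "theta (theta B) = B"
  by (rule arcs_False_inject) (simp add: arcs_theta rev_map comp_def)

lemma phi_theta_tilde: "phi (theta_tilde T) = theta (phi T)"
  by (simp add: theta_tilde_def bij_is_surj[OF bij_phi] surj_f_inv_f)

lemma theta_tilde_theta_tilde: "theta_tilde (theta_tilde T) = T"
  by (rule injD[OF bij_is_inj[OF bij_phi]]) (simp add: phi_theta_tilde theta_theta)

lemma edges_theta_tilde: "edges (theta_tilde T) = edges T"
  by (simp add: phi_theta_tilde size_theta flip: size_phi)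


section \<open>Degrees and the right arm\<close>

fun right_spine :: "'a tree \<Rightarrow> nat" where
  "right_spine \<langle>\<rangle> = 0"
| "right_spine \<langle>l, x, r\<rangle> = Suc (right_spine r)"

text \<open>\<open>chains k t\<close> has the lengths of the right chains of \<open>t\<close>, with \<open>k\<close> added to that of the root.\<close>

fun chains :: "nat \<Rightarrow> 'a tree \<Rightarrow> nat multiset" where
  "chains k \<langle>\<rangle> = (if k = 0 then {#} else {#k#})"
| "chains k \<langle>l, x, r\<rangle> = chains 0 l + chains (Suc k) r"

text \<open>The root chain is left out because \<open>theta_aux\<close> prolongs that of
  \<open>t2\<close>.\<close>

fun inner_chains :: "'a tree \<Rightarrow> nat multiset" where
  "inner_chains \<langle>\<rangle> = {#}"
| "inner_chains \<langle>l, x, r\<rangle> = chains 0 l + inner_chains r"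

lemma chains_map_tree [simp]: "chains k (map_tree f t) = chains k t"
  by (induction t arbitrary: k) auto

lemma chains_eq:
  "chains k t = (if k + right_spine t = 0 then {#} else {#k + right_spine t#}) + inner_chains t"
  by (induction t arbitrary: k) auto

text \<open>The root chain of \<open>t2\<close> is joined to that of \<open>B\<close>; all other
  chains keep their lengths.\<close>

lemma chains_theta_aux:
  "B \<noteq> \<langle>\<rangle> \<or> t2 = \<langle>\<rangle> \<Longrightarrow>
   chains 0 (theta_aux i B t1 t2) = chains (right_spine t2) B + chains 0 t1 + inner_chains t2"
proof (induction B arbitrary: i t1 t2)
  case (Node l x r)
  then show ?case using chains_eq[of "Suc 0" t2] by (cases "r = \<langle>\<rangle>") (auto simp: ac_simps)
qed simp

lemma chains_theta: "chains 0 (theta B) = chains 0 B"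
  by (simp add: theta_eq chains_theta_aux)

text \<open>The next sibling is the right child, so sibling groups become right chains;
  \<open>k\<close> counts siblings already passed.\<close>

lemma chains_phi_forest:
  "chains k (phi_forest ts) =
     (if k + length ts = 0 then {#} else {#k + length ts#}) + (\<Sum>t\<leftarrow>ts. degree_sequence t)"
  by (induction ts arbitrary: k rule: phi_forest.induct) (auto simp: ac_simps)

lemma degree_sequence_eq_chains: "degree_sequence T = chains 0 (phi T)"
  by (cases T) (auto simp: phi_def chains_phi_forest)

text \<open>Counts the youngest siblings along the right arm, one for each outer block.\<close>

fun right_arm :: "'a tree \<Rightarrow> nat" where
  "right_arm \<langle>\<rangle> = 0"
| "right_arm \<langle>l, x, r\<rangle> = (if r = \<langle>\<rangle> then Suc (right_arm l) else right_arm r)"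

lemma right_arm_map_tree [simp]: "right_arm (map_tree f t) = right_arm t"
  by (induction t) auto

lemma right_arm_pos: "t \<noteq> \<langle>\<rangle> \<Longrightarrow> 0 < right_arm t"
  by (induction t) auto

text \<open>If \<open>t2\<close> is nonempty, its root chain merges with that of \<open>B\<close>,
  so one outer block is counted twice, and \<open>t1\<close> lies under an arc.\<close>

lemma right_arm_theta_aux:
  "B \<noteq> \<langle>\<rangle> \<or> t2 = \<langle>\<rangle> \<Longrightarrow>
   right_arm (theta_aux i B t1 t2) =
     (if t2 = \<langle>\<rangle> then right_arm B + right_arm t1 else right_arm B + right_arm t2 - 1)"
proof (induction B arbitrary: i t1 t2)
  case (Node l x r)
  then show ?case using right_arm_pos[of r] by (cases "r = \<langle>\<rangle>") auto
qed simp

lemma right_arm_theta: "right_arm (theta B) = right_arm B"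
  by (simp add: theta_eq right_arm_theta_aux)

lemma phi_forest_eq_Leaf_iff [simp]: "phi_forest ts = \<langle>\<rangle> \<longleftrightarrow> ts = []"
  by (cases ts rule: phi_forest.cases) auto

lemma rarm_eq_right_arm: "rarm T = right_arm (phi T)"
proof -
  have "rarm (PNode ts) = right_arm (phi_forest ts)" for ts
    by (induction ts rule: phi_forest.induct) auto
  then show ?thesis by (cases T) (simp add: phi_def)
qed


section \<open>The left arm and the reverse preorder\<close>

lemma takeWhile_append_stop:
  "ys = [] \<or> \<not> P (hd ys) \<Longrightarrow> takeWhile P (xs @ ys) = takeWhile P xs"
  by (cases ys) (auto simp: takeWhile_append takeWhile_eq_all_conv[THEN iffD2])

text \<open>Preorder runs down the left arm first; the next node, if any, is a right child.\<close>

lemma larm_eq_arcs: "larm T = length (takeWhile (Not \<circ> fst) (arcs False (phi T)))"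
proof (induction T rule: larm.induct)
  case (2 t ts)
  have "takeWhile (Not \<circ> fst) (arcs False (phi t) @ arcs True (phi_forest ts)) =
      takeWhile (Not \<circ> fst) (arcs False (phi t))"
    using fst_hd_arcs[of "phi_forest ts" True] by (intro takeWhile_append_stop) auto
  then show ?case using 2 by (cases t) (simp add: phi_def comp_def)
qed (simp add: phi_def)

lemma younger_flags_forest_eq_arcs: "younger_flags_forest ts = map snd (arcs g (phi_forest ts))"
  by (induction ts arbitrary: g rule: phi_forest.induct) auto

lemma path_tree_Suc: "path_tree (Suc n) = PNode [path_tree n]"
  by (simp add: path_tree_def)

lemma edges_path_tree [simp]: "edges (path_tree n) = n"
  by (induction n) (simp_all add: path_tree_Suc, simp add: path_tree_def)

lemma younger_flags_forest_singleton:
  "younger_flags_forest [t] = False # younger_flags_forest (children t)"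
  by (cases t) simp

lemma younger_flags_path_tree:
  "younger_flags_forest (children (path_tree n)) = replicate n False"
proof (induction n)
  case (Suc n)
  then show ?case by (simp add: path_tree_Suc younger_flags_forest_singleton)
qed (simp add: path_tree_def)

text \<open>Without younger siblings every node has at most one child.\<close>

lemma path_tree_if_younger_flags:
  "True \<notin> set (younger_flags_forest ts) \<Longrightarrow> PNode ts = path_tree (edges (PNode ts))"
  by (induction ts rule: younger_flags_forest.induct)
    (simp add: path_tree_def, fastforce simp: path_tree_Suc)

text \<open>Omitting the root's flag absorbs the convention for paths; in other trees the scan stops
  before reaching the root.\<close>

lemma rev_stat_eq_arcs: "rev_stat T = length (takeWhile (Not \<circ> snd) (rev (arcs False (phi T))))"
proof -
  obtain ts where T: "T = PNode ts" by (cases T)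
  let ?f = "younger_flags_forest ts"
  have "rev_stat T = length (takeWhile Not (rev ?f))"
  proof (cases "T = path_tree (edges T)")
    case True
    then have "?f = replicate (edges T) False"
      using younger_flags_path_tree[of "edges T"] T by (metis ptree.sel)
    then show ?thesis using True by (simp add: rev_stat_def)
  next
    case False
    then have "True \<in> set (rev ?f)" using path_tree_if_younger_flags[of ts] T by auto
    then show ?thesis using False T
      by (simp add: rev_stat_def younger_flags_def takeWhile_append1)
  qed
  also have "?f = map snd (arcs False (phi T))"
    by (simp add: T phi_def younger_flags_forest_eq_arcs[of ts False])
  finally show ?thesis by (simp add: rev_map takeWhile_map)
qed

lemma larm_theta_tilde: "larm (theta_tilde T) = rev_stat T"
  by (simp add: larm_eq_arcs rev_stat_eq_arcs phi_theta_tilde arcs_theta takeWhile_map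
      rev_map comp_def)

lemma rev_stat_theta_tilde: "rev_stat (theta_tilde T) = larm T"
  using larm_theta_tilde[of "theta_tilde T"] by (simp add: theta_tilde_theta_tilde)


section \<open>The Catalan triangle\<close>

definition tree_lists :: "nat \<Rightarrow> nat \<Rightarrow> ptree list set" where
  "tree_lists k m = {ts. length ts = k \<and> (\<Sum>t\<leftarrow>ts. edges t) = m}"

lemma tree_lists_0: "tree_lists 0 m = (if m = 0 then {[]} else {})"
  by (auto simp: tree_lists_def)

lemma edges_eq_0_iff: "edges t = 0 \<longleftrightarrow> t = PNode []"
  by (cases t rule: edges.cases) (auto simp: neq_Nil_conv)

lemma tree_lists_Suc_0: "tree_lists (Suc k) 0 = (#) (PNode []) ` tree_lists k 0"
  by (auto simp: tree_lists_def length_Suc_conv edges_eq_0_iff)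

text \<open>Undoes cutting the leftmost edge of the first tree. The last equation is a default for
  lists with fewer than two trees.\<close>

fun join :: "ptree list \<Rightarrow> ptree list" where
  "join (t # PNode us # ts) = PNode (t # us) # ts"
| "join ts = ts"

text \<open>The first tree is a single node, which is removed, or has a leftmost edge, which is
  cut.\<close>

lemma tree_lists_Suc_Suc:
  "tree_lists (Suc k) (Suc m) =
     (#) (PNode []) ` tree_lists k (Suc m) \<union> join ` tree_lists (Suc (Suc k)) m"
proof (intro equalityI subsetI)
  fix ts assume "ts \<in> tree_lists (Suc k) (Suc m)"
  then obtain us vs where ts: "ts = PNode us # vs" and len: "length vs = k"
    and sum: "edges (PNode us) + (\<Sum>t\<leftarrow>vs. edges t) = Suc m"
    by (cases ts; cases "hd ts") (auto simp: tree_lists_def)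
  show "ts \<in> (#) (PNode []) ` tree_lists k (Suc m) \<union> join ` tree_lists (Suc (Suc k)) m"
  proof (cases us)
    case Nil
    then show ?thesis using ts len sum by (auto simp: tree_lists_def)
  next
    case (Cons u us')
    then have "ts = join (u # PNode us' # vs)" using ts by simp
    moreover have "u # PNode us' # vs \<in> tree_lists (Suc (Suc k)) m"
      using len sum Cons by (simp add: tree_lists_def)
    ultimately show ?thesis by blast
  qed
next
  fix ts
  assume "ts \<in> (#) (PNode []) ` tree_lists k (Suc m) \<union> join ` tree_lists (Suc (Suc k)) m"
  then consider us where "ts = PNode [] # us" "us \<in> tree_lists k (Suc m)"
    | us where "ts = join us" "us \<in> tree_lists (Suc (Suc k)) m" by blast
  then show "ts \<in> tree_lists (Suc k) (Suc m)"
  proof cases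
    case 2
    then show ?thesis by (cases us rule: join.cases) (auto simp: tree_lists_def)
  qed (simp add: tree_lists_def)
qed

lemma inj_on_join: "inj_on join (tree_lists (Suc (Suc k)) m)"
proof (rule inj_onI)
  fix ts us
  assume "ts \<in> tree_lists (Suc (Suc k)) m" "us \<in> tree_lists (Suc (Suc k)) m" "join ts = join us"
  then show "ts = us"
    by (cases ts rule: join.cases; cases us rule: join.cases) (auto simp: tree_lists_def)
qed

lemma join_neq_leaf_Cons: "ts \<in> tree_lists (Suc (Suc k)) m \<Longrightarrow> PNode [] # us \<noteq> join ts"
  by (cases ts rule: join.cases) (auto simp: tree_lists_def)

text \<open>A ballot number as a difference of binomials, stated additively to avoid truncated
  subtraction. The recurrence lowers \<open>m\<close>, or keeps it and shortens the list; hence the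
  nested inductions.\<close>

lemma finite_card_tree_lists:
  "finite (tree_lists (Suc k) m) \<and>
   card (tree_lists (Suc k) m) + (if m = 0 then 0 else (2 * m + k) choose (m - 1)) =
     (2 * m + k) choose m"
proof (induction m arbitrary: k)
  case 0
  have "finite (tree_lists k 0) \<and> card (tree_lists k 0) = 1" for k
    by (induction k) (auto simp: tree_lists_0 tree_lists_Suc_0 card_image)
  then show ?case by auto
next
  case (Suc m)
  note IH = Suc.IH
  have step: "finite (tree_lists (Suc k) (Suc m)) \<and> card (tree_lists (Suc k) (Suc m)) =
      card (tree_lists k (Suc m)) + card (tree_lists (Suc (Suc k)) m)"
    if "finite (tree_lists k (Suc m))" for k
  proof -
    have "(#) (PNode []) ` tree_lists k (Suc m) \<inter> join ` tree_lists (Suc (Suc k)) m = {}"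
      using join_neq_leaf_Cons by blast
    then show ?thesis
      using that IH[of "Suc k", THEN conjunct1]
      by (simp add: tree_lists_Suc_Suc card_Un_disjoint card_image inj_on_join)
  qed
  \<comment> \<open>As \<open>2 * Suc m + k = 2 * m + Suc (Suc k)\<close>, Pascal's rule yields the
    binomials of both smaller cases.\<close>
  have pascal: "(2 * Suc m + Suc k) choose Suc m =
      ((2 * Suc m + k) choose Suc m) + ((2 * m + Suc (Suc k)) choose m)" for k
    by simp
  have pascal': "(2 * Suc m + Suc k) choose m = ((2 * Suc m + k) choose m) +
      (if m = 0 then 0 else (2 * m + Suc (Suc k)) choose (m - 1))" for k
    by (cases m) simp_all
  show ?case
  proof (induction k)
    case 0
    \<comment> \<open>The empty list contributes nothing here; by symmetry Pascal's rule halves the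
      central binomial.\<close>
    have "(2 * m + 1) choose m = (2 * m + 1) choose Suc m"
      using binomial_symmetric[of m "2 * m + 1"] by simp
    then have mid: "(2 * Suc m + 0) choose Suc m = 2 * ((2 * m + 1) choose m)"
      by simp
    have low: "(2 * Suc m + 0) choose m =
        ((2 * m + 1) choose m) + (if m = 0 then 0 else (2 * m + 1) choose (m - 1))"
      by (cases m) simp_all
    have s: "finite (tree_lists (Suc 0) (Suc m))"
      "card (tree_lists (Suc 0) (Suc m)) = card (tree_lists (Suc 1) m)"
      using step[of 0] by (simp_all add: tree_lists_0)
    show ?case
      using s IH[of 1, THEN conjunct2] mid low
      by (simp only: nat.distinct if_False diff_Suc_1 simp_thms)
  next
    case (Suc k)
    then have "finite (tree_lists (Suc k) (Suc m))" by blast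
    note s = step[OF this]
    show ?case
      using s[THEN conjunct1] s[THEN conjunct2] Suc[THEN conjunct2]
        IH[of "Suc (Suc k)", THEN conjunct2] pascal[of k] pascal'[of k]
      by (simp only: nat.distinct if_False diff_Suc_1 simp_thms)
  qed
qed

lemma card_tree_lists:
  assumes "0 < k"
  shows "real (card (tree_lists k m)) = real k / real (2 * m + k) * real ((2 * m + k) choose m)"
proof -
  obtain j where k: "k = Suc j" using assms gr0_implies_Suc by blast
  show ?thesis
  proof (cases m)
    case 0
    then show ?thesis using finite_card_tree_lists[of j 0] k by simp
  next
    case (Suc i)
    define p where "p = 2 * m + j"
    have "card (tree_lists k m) + (p choose i) = p choose m"
      using finite_card_tree_lists[of j m] Suc k by (simp add: p_def)
    then have "real (card (tree_lists k m)) = real (p choose m) - real (p choose i)"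
      by linarith
    \<comment> \<open>After multiplication by \<open>Suc p\<close>, absorption turns both terms into
      multiples of \<open>Suc p choose m\<close>, with factors \<open>Suc p - m\<close> and
      \<open>m\<close> differing by \<open>k\<close>.\<close>
    then have "real (Suc p) * card (tree_lists k m) =
        real (Suc p * (p choose m)) - real (Suc p * (p choose i))"
      by (simp only: of_nat_mult right_diff_distrib)
    also have "Suc p * (p choose m) = (Suc p - m) * (Suc p choose m)"
      using binomial_absorb_comp[of "Suc p" m] by simp
    also have "Suc p * (p choose i) = m * (Suc p choose m)"
      using binomial_absorption[of i "Suc p"] Suc by simp
    also have "real ((Suc p - m) * (Suc p choose m)) - real (m * (Suc p choose m)) =
        real k * real (Suc p choose m)"
      by (simp add: p_def k of_nat_diff algebra_simps)
    finally show ?thesis by (simp add: p_def k field_simps)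
  qed
qed

text \<open>Cuts all edges of the left arm and drops the final leaf, so the list has one tree per
  arm edge.\<close>

fun left_arm_list :: "ptree \<Rightarrow> ptree list" where
  "left_arm_list (PNode []) = []"
| "left_arm_list (PNode (t # ts)) = PNode ts # left_arm_list t"

fun graft :: "ptree list \<Rightarrow> ptree" where
  "graft [] = PNode []"
| "graft (PNode us # ts) = PNode (graft ts # us)"

lemma graft_left_arm_list: "graft (left_arm_list T) = T"
  by (induction T rule: left_arm_list.induct) auto

lemma left_arm_list_graft: "left_arm_list (graft ts) = ts"
  by (induction ts rule: graft.induct) auto

lemma length_left_arm_list: "length (left_arm_list T) = larm T"
  by (induction T rule: left_arm_list.induct) auto

lemma edges_left_arm_list: "edges T = larm T + (\<Sum>t\<leftarrow>left_arm_list T. edges t)"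
  by (induction T rule: left_arm_list.induct) auto

lemma card_larm:
  assumes "k \<le> n"
  shows "card {T \<in> plane_trees n. larm T = k} = card (tree_lists k (n - k))"
proof (rule bij_betw_same_card[OF bij_betwI])
  show "left_arm_list \<in> {T \<in> plane_trees n. larm T = k} \<rightarrow> tree_lists k (n - k)"
  proof
    fix T assume "T \<in> {T \<in> plane_trees n. larm T = k}"
    then show "left_arm_list T \<in> tree_lists k (n - k)"
      using edges_left_arm_list[of T]
      by (auto simp: plane_trees_def tree_lists_def length_left_arm_list)
  qed
  show "graft \<in> tree_lists k (n - k) \<rightarrow> {T \<in> plane_trees n. larm T = k}"
  proof
    fix ts assume "ts \<in> tree_lists k (n - k)"
    then show "graft ts \<in> {T \<in> plane_trees n. larm T = k}"
      using assms edges_left_arm_list[of "graft ts"] length_left_arm_list[of "graft ts"]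
      by (simp add: plane_trees_def tree_lists_def left_arm_list_graft)
  qed
qed (simp_all add: graft_left_arm_list left_arm_list_graft)

lemma card_rev_stat:
  "card {T \<in> plane_trees n. rev_stat T = k} = card {T \<in> plane_trees n. larm T = k}"
  by (rule bij_betw_same_card[OF bij_betwI[of theta_tilde _ _ theta_tilde]])
    (auto simp: plane_trees_def edges_theta_tilde larm_theta_tilde rev_stat_theta_tilde
      theta_tilde_theta_tilde)

theorem proposition3p3:
  fixes n :: nat
  assumes "n \<ge> 1"
  shows "(\<forall>T \<in> plane_trees n.
            theta_tilde T \<in> plane_trees n \<and>
            theta_tilde (theta_tilde T) = T \<and>
            degree_sequence (theta_tilde T) = degree_sequence T \<and>
            rarm (theta_tilde T) = rarm T \<and>
            larm (theta_tilde T) = rev_stat T \<and>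
            rev_stat (theta_tilde T) = larm T) \<and>
         (\<forall>k. 1 \<le> k \<and> k \<le> n \<longrightarrow>
            real (card {T \<in> plane_trees n. rev_stat T = k}) =
              real k / real (2 * n - k) * real ((2 * n - k) choose n))"
proof (intro conjI ballI allI impI)
  fix T assume "T \<in> plane_trees n"
  then show "theta_tilde T \<in> plane_trees n" by (simp add: plane_trees_def edges_theta_tilde)
  show "theta_tilde (theta_tilde T) = T" by (rule theta_tilde_theta_tilde)
  show "degree_sequence (theta_tilde T) = degree_sequence T"
    by (simp add: degree_sequence_eq_chains phi_theta_tilde chains_theta)
  show "rarm (theta_tilde T) = rarm T"
    by (simp add: rarm_eq_right_arm phi_theta_tilde right_arm_theta)
  show "larm (theta_tilde T) = rev_stat T" by (rule larm_theta_tilde)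
  show "rev_stat (theta_tilde T) = larm T" by (rule rev_stat_theta_tilde)
next
  fix k assume k: "1 \<le> k \<and> k \<le> n"
  then have "2 * (n - k) + k = 2 * n - k" by linarith
  moreover have "n \<le> 2 * n - k" "2 * n - k - n = n - k" using k by linarith+
  \<comment> \<open>The count for lists with \<open>n - k\<close> edges has lower index
    \<open>n - k\<close>; symmetry changes it to \<open>n\<close>.\<close>
  then have "(2 * n - k) choose (n - k) = (2 * n - k) choose n"
    using binomial_symmetric[of n "2 * n - k"] by simp
  ultimately show "real (card {T \<in> plane_trees n. rev_stat T = k}) =
      real k / real (2 * n - k) * real ((2 * n - k) choose n)"
    using k card_tree_lists[of k "n - k"] by (simp add: card_rev_stat card_larm)
qed

end
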